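(* Let $a<0$ and $b$ be real constants, let $I\subset(0,\infty)$ and $J\subset\mathbb{R}$ be open intervals, and let $\varphi:J\to\mathbb{R}$ be a smooth function with $\dot\varphi^2+\varphi^2>0$ on $J$. Let $\mathcal{M}'''_m$ be the developable meridian surface of parabolic type in the Minkowski space $\mathbb{R}^4_1$ parametrized by $$z(u,v)=u\,\varphi(v)\cos v\,e_1+u\,\varphi(v)\sin v\,e_2+\left(u\,\frac{\varphi(v)^2}{2}+au+b\right)\xi_1+u\,\xi_2,\qquad u\in I,\ v\in J.$$ Then $\mathcal{M}'''_m$ is marginally trapped if and only if $$\overline{\kappa}^2(v)=-\frac{1}{2a}\quad\text{for all } v\in J,$$ where $\displaystyle \overline{\kappa}(v)=\frac{\varphi\ddot\varphi-2\dot\varphi^2-\varphi^2}{(\dot\varphi^2+\varphi^2)^{3/2}}$.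
   Context: $\mathbb{R}^4_1$ is $\mathbb{R}^4$ with the flat metric $\langle\cdot,\cdot\rangle=dx_1^2+dx_2^2+dx_3^2-dx_4^2$ and standard orthonormal basis $e_1,e_2,e_3,e_4$ (so $e_1^2=e_2^2=e_3^2=1$, $e_4^2=-1$). Put $\xi_1=\frac{e_3+e_4}{\sqrt2}$, $\xi_2=\frac{-e_3+e_4}{\sqrt2}$; then $\langle\xi_1,\xi_1\rangle=\langle\xi_2,\xi_2\rangle=0$ and $\langle\xi_1,\xi_2\rangle=-1$. Dots denote derivatives with respect to $v$. A meridian surface of parabolic type is a surface of the form $z(u,v)=f(u)\varphi(v)\cos v\,e_1+f(u)\varphi(v)\sin v\,e_2+\left(f(u)\frac{\varphi(v)^2}{2}+g(u)\right)\xi_1+f(u)\,\xi_2$, with $f,g$ smooth, $f>0$ and $-f'g'>0$; the surface in the claim is the case $f(u)=u$, $g(u)=au+b$. It is spacelike, i.e. the induced metric is Riemannian. For a spacelike surface $M^2$ in $\mathbb{R}^4_1$, let $\nabla'$ and $\nabla$ be the Levi-Civita connections of $\mathbb{R}^4_1$ and $M^2$, let $\sigma(x,y)=\nabla'_xy-\nabla_xy$ be the second fundamental tensor, and let $H=\frac12\operatorname{tr}\sigma$ be the mean curvature vector field. A spacelike surface is called marginally trapped if $H$ is lightlike (i.e. $H\neq0$ and $\langle H,H\rangle=0$) at each point. *)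

theory Defs
  imports "HOL-Analysis.Analysis"
begin

text \<open>
  On an open set, the existence of all iterated partial derivatives as (Frechet) differentiable
  functions is the usual $C^\infty$ condition. For real functions of one variable the only basis
  vector is 1, and \<open>partial_deriv 1\<close> is the ordinary derivative.
\<close>

definition partial_deriv ::
  "'a::euclidean_space \<Rightarrow> ('a \<Rightarrow> 'b::real_normed_vector) \<Rightarrow> 'a \<Rightarrow> 'b" where
  "partial_deriv e f = (\<lambda>x. frechet_derivative f (at x) e)"

definition smooth_on :: "'a::euclidean_space set \<Rightarrow> ('a \<Rightarrow> 'b::real_normed_vector) \<Rightarrow> bool" where
  "smooth_on S f \<longleftrightarrow>
     (\<forall>es \<in> lists Basis. \<forall>x\<in>S. foldr partial_deriv es f differentiable (at x))"

definition mink :: "real^4 \<Rightarrow> real^4 \<Rightarrow> real" where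
  "mink x y = x $ 1 * y $ 1 + x $ 2 * y $ 2 + x $ 3 * y $ 3 - x $ 4 * y $ 4"

definition lightlike :: "real^4 \<Rightarrow> bool" where
  "lightlike x \<longleftrightarrow> x \<noteq> 0 \<and> mink x x = 0"

abbreviation e1 :: "real^4" where "e1 \<equiv> axis 1 1"
abbreviation e2 :: "real^4" where "e2 \<equiv> axis 2 1"
abbreviation e3 :: "real^4" where "e3 \<equiv> axis 3 1"
abbreviation e4 :: "real^4" where "e4 \<equiv> axis 4 1"

definition xi1 :: "real^4" where
  "xi1 = (1 / sqrt 2) *\<^sub>R (e3 + e4)"

definition xi2 :: "real^4" where
  "xi2 = (1 / sqrt 2) *\<^sub>R (- e3 + e4)"

text \<open>
  A surface is given by a parametrization \<open>z\<close> on an open subset of the coordinate plane. Tangent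
  vectors and tangent vector fields of the surface are represented by their components with
  respect to the coordinate frame, i.e. by elements of \<open>real^2\<close> and functions \<open>real^2 \<Rightarrow> real^2\<close>;
  \<open>tangent_map z p\<close> sends components at \<open>p\<close> to the tangent vector in Minkowski space.
\<close>

definition tangent_map :: "(real^2 \<Rightarrow> real^4) \<Rightarrow> real^2 \<Rightarrow> real^2 \<Rightarrow> real^4" where
  "tangent_map z p = frechet_derivative z (at p)"

definition induced_metric :: "(real^2 \<Rightarrow> real^4) \<Rightarrow> real^2 \<Rightarrow> real^2 \<Rightarrow> real^2 \<Rightarrow> real" where
  "induced_metric z p x y = mink (tangent_map z p x) (tangent_map z p y)"

definition metric_matrix :: "(real^2 \<Rightarrow> real^4) \<Rightarrow> real^2 \<Rightarrow> real^2^2" where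
  "metric_matrix z p = (\<chi> i j. induced_metric z p (axis i 1) (axis j 1))"

definition spacelike_surface :: "(real^2 \<Rightarrow> real^4) \<Rightarrow> (real^2) set \<Rightarrow> bool" where
  "spacelike_surface z U \<longleftrightarrow>
     open U \<and> smooth_on U z \<and> (\<forall>p\<in>U. \<forall>x. x \<noteq> 0 \<longrightarrow> induced_metric z p x x > 0)"

definition christoffel :: "(real^2 \<Rightarrow> real^4) \<Rightarrow> real^2 \<Rightarrow> 2 \<Rightarrow> 2 \<Rightarrow> 2 \<Rightarrow> real" where
  "christoffel z p k i j =
     (1 / 2) * (\<Sum>l\<in>UNIV. matrix_inv (metric_matrix z p) $ k $ l *
        (partial_deriv (axis i 1) (\<lambda>q. metric_matrix z q $ j $ l) p
         + partial_deriv (axis j 1) (\<lambda>q. metric_matrix z q $ i $ l) p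
         - partial_deriv (axis l 1) (\<lambda>q. metric_matrix z q $ i $ j) p))"

definition levi_civita ::
  "(real^2 \<Rightarrow> real^4) \<Rightarrow> (real^2 \<Rightarrow> real^2) \<Rightarrow> (real^2 \<Rightarrow> real^2) \<Rightarrow> real^2 \<Rightarrow> real^2" where
  "levi_civita z X Y p =
     (\<chi> k. frechet_derivative (\<lambda>q. Y q $ k) (at p) (X p)
          + (\<Sum>i\<in>UNIV. \<Sum>j\<in>UNIV. christoffel z p k i j * X p $ i * Y p $ j))"

text \<open>
  The Levi-Civita connection of flat Minkowski space, applied to the tangent field with components
  \<open>Y\<close> along the surface: differentiation of the \<open>real^4\<close>-valued field in direction \<open>X\<close>.
\<close>

definition ambient_connection ::
  "(real^2 \<Rightarrow> real^4) \<Rightarrow> (real^2 \<Rightarrow> real^2) \<Rightarrow> (real^2 \<Rightarrow> real^2) \<Rightarrow> real^2 \<Rightarrow> real^4" where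
  "ambient_connection z X Y p = frechet_derivative (\<lambda>q. tangent_map z q (Y q)) (at p) (X p)"

definition second_fundamental ::
  "(real^2 \<Rightarrow> real^4) \<Rightarrow> (real^2 \<Rightarrow> real^2) \<Rightarrow> (real^2 \<Rightarrow> real^2) \<Rightarrow> real^2 \<Rightarrow> real^4" where
  "second_fundamental z X Y p =
     ambient_connection z X Y p - tangent_map z p (levi_civita z X Y p)"

text \<open>The trace with respect to the induced metric, computed in the coordinate frame.\<close>

definition mean_curvature_vector :: "(real^2 \<Rightarrow> real^4) \<Rightarrow> real^2 \<Rightarrow> real^4" where
  "mean_curvature_vector z p =
     (1 / 2) *\<^sub>R (\<Sum>i\<in>UNIV. \<Sum>j\<in>UNIV. matrix_inv (metric_matrix z p) $ i $ j *\<^sub>R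
        second_fundamental z (\<lambda>_. axis i 1) (\<lambda>_. axis j 1) p)"

definition marginally_trapped :: "(real^2 \<Rightarrow> real^4) \<Rightarrow> (real^2) set \<Rightarrow> bool" where
  "marginally_trapped z U \<longleftrightarrow>
     spacelike_surface z U \<and> (\<forall>p\<in>U. lightlike (mean_curvature_vector z p))"

text \<open>The parameters are \<open>u = p $ 1\<close> and \<open>v = p $ 2\<close>.\<close>

definition meridian_parabolic ::
  "(real \<Rightarrow> real) \<Rightarrow> (real \<Rightarrow> real) \<Rightarrow> (real \<Rightarrow> real) \<Rightarrow> real^2 \<Rightarrow> real^4" where
  "meridian_parabolic f g \<phi> p =
     (let u = p $ 1; v = p $ 2 in
        (f u * \<phi> v * cos v) *\<^sub>R e1
      + (f u * \<phi> v * sin v) *\<^sub>R e2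
      + (f u * ((\<phi> v)\<^sup>2 / 2) + g u) *\<^sub>R xi1
      + f u *\<^sub>R xi2)"

definition kappa_bar :: "(real \<Rightarrow> real) \<Rightarrow> real \<Rightarrow> real" where
  "kappa_bar \<phi> v =
     (\<phi> v * deriv (deriv \<phi>) v - 2 * (deriv \<phi> v)\<^sup>2 - (\<phi> v)\<^sup>2)
       / ((deriv \<phi> v)\<^sup>2 + (\<phi> v)\<^sup>2) powr (3 / 2)"

end

theory Submission
  imports Defs
begin

text \<open>
  The surface is ruled over a curve on the light cone. Put \<open>n = \<xi>\<^sub>1\<close> and
  \<open>c(v) = \<phi> cos v e\<^sub>1 + \<phi> sin v e\<^sub>2 + \<phi>\<^sup>2/2 \<xi>\<^sub>1 + \<xi>\<^sub>2\<close>, so that \<open>z = u c(v) + (a u + b) n\<close>.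
  The curve satisfies \<open>\<langle>c, c\<rangle> = 0\<close> and \<open>\<langle>c, n\<rangle> = -1\<close>, and \<open>n\<close> is null. These three relations, together
  with the ones obtained by differentiating them, determine every inner product that enters the
  mean curvature except \<open>w = \<langle>c', c'\<rangle>\<close>, \<open>\<langle>c', c''\<rangle> = w'/2\<close> and \<open>\<langle>c'', c''\<rangle>\<close>.

  The metric comes out as \<open>E = -2a\<close>, \<open>F = 0\<close>, \<open>G = u\<^sup>2 w\<close>; it is positive definite since \<open>a < 0\<close>, \<open>u > 0\<close>
  and \<open>w > 0\<close>. The
  rulings are straight lines with constant \<open>E\<close>, so \<open>\<sigma>(z\<^sub>u, z\<^sub>u) = 0\<close>, and \<open>H\<close> is the normal part of
  \<open>z\<^sub>v\<^sub>v = u c''\<close> divided by \<open>2G\<close>: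
  \<open>2 u w H = N\<close> with \<open>N = c'' - w/(2a) (c + a n) - \<langle>c', c''\<rangle>/w c'\<close>.
  Since \<open>\<langle>N, n\<rangle> = w/(2a) \<noteq> 0\<close>, the vector \<open>H\<close> never vanishes, and being marginally trapped reduces to
  \<open>w \<langle>N, N\<rangle> = w \<langle>c'', c''\<rangle> - \<langle>c', c''\<rangle>\<^sup>2 + w\<^sup>3/(2a) = 0\<close>.

  The derivatives of \<open>c\<close> have no \<open>\<xi>\<^sub>2\<close> component, so their products are the Euclidean ones of the plane
  polar curve with radius \<open>\<phi>\<close>. By Lagrange's identity
  \<open>w \<langle>c'', c''\<rangle> - \<langle>c', c''\<rangle>\<^sup>2\<close> is then the squared determinant of that curve's first two derivatives,
  that is \<open>\<kappa>\<^sup>2 w\<^sup>3\<close> for its curvature \<open>\<kappa>\<close>, which agrees with \<open>kappa_bar \<phi>\<close> up to sign. Dividing by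
  \<open>w\<^sup>3\<close> gives the criterion \<open>\<kappa>\<^sup>2 = -1/(2a)\<close>.

  Being marginally trapped also includes smoothness of \<open>z\<close>, which is proved with a small calculus of
  smooth functions based on \<open>smooth_on_coinduct\<close>.
\<close>

section \<open>Calculus of smooth functions\<close>

lemma smooth_on_has_derivative:
  assumes "smooth_on S f" and "x \<in> S"
  shows "(f has_derivative frechet_derivative f (at x)) (at x)"
proof -
  have "foldr partial_deriv [] f differentiable (at x)"
    using assms unfolding smooth_on_def by blast
  then show ?thesis by (simp add: frechet_derivative_works)
qed

lemma smooth_on_partial_deriv:
  assumes "smooth_on S f" and "e \<in> Basis"
  shows "smooth_on S (partial_deriv e f)"
  unfolding smooth_on_def
proof (intro ballI)
  fix es x assume "es \<in> lists (Basis :: 'a set)" and x: "x \<in> S"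
  then have "es @ [e] \<in> lists Basis" using assms(2) by simp
  then have "foldr partial_deriv (es @ [e]) f differentiable (at x)"
    using assms(1) x unfolding smooth_on_def by blast
  then show "foldr partial_deriv es (partial_deriv e f) differentiable (at x)" by simp
qed

text \<open>
  A family of differentiable functions that is closed under partial derivatives consists of smooth
  functions. This replaces formulas for iterated derivatives: each closure property below only needs a
  suitable family. The members need not themselves be the iterated partial derivatives, they only have
  to agree with them on the open set \<open>S\<close>.
\<close>

lemma smooth_on_coinduct:
  assumes "open S" and "P f"
    and step: "\<And>f. P f \<Longrightarrow> \<exists>D. (\<forall>x\<in>S. (f has_derivative D x) (at x)) \<and> (\<forall>e\<in>Basis. P (\<lambda>x. D x e))"
  shows "smooth_on S f"
proof -
  have iter: "\<exists>g. P g \<and> (\<forall>x\<in>S. foldr partial_deriv es f x = g x)" if "es \<in> lists Basis" for es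
    using that
  proof (induction es)
    case Nil
    then show ?case using assms(2) by auto
  next
    case (Cons e es)
    then obtain g where g: "P g" "\<forall>x\<in>S. foldr partial_deriv es f x = g x" by auto
    obtain D where D: "\<forall>x\<in>S. (g has_derivative D x) (at x)" "\<forall>e\<in>Basis. P (\<lambda>x. D x e)"
      using step[OF g(1)] by blast
    have "partial_deriv e (foldr partial_deriv es f) x = D x e" if "x \<in> S" for x
    proof -
      have "(foldr partial_deriv es f has_derivative D x) (at x)"
        using has_derivative_transform_within_open[of g "D x" x UNIV S] D(1) that assms(1) g(2)
        by auto
      from frechet_derivative_at[OF this] show ?thesis by (simp add: partial_deriv_def)
    qed
    then show ?case using D(2) Cons.hyps by (intro exI[of _ "\<lambda>x. D x e"]) (use Cons.prems in auto)
  qed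
  show ?thesis
    unfolding smooth_on_def
  proof (intro ballI)
    fix es x assume es: "es \<in> lists (Basis :: 'a set)" and x: "x \<in> S"
    obtain g where g: "P g" "\<forall>x\<in>S. foldr partial_deriv es f x = g x"
      using iter[OF es] by blast
    obtain D where "\<forall>x\<in>S. (g has_derivative D x) (at x)" using step[OF g(1)] by blast
    then have "(foldr partial_deriv es f has_derivative D x) (at x)"
      using has_derivative_transform_within_open[of g "D x" x UNIV S] x assms(1) g(2) by auto
    then show "foldr partial_deriv es f differentiable (at x)" by (rule differentiableI)
  qed
qed

lemma smooth_on_const:
  assumes "open S"
  shows "smooth_on S (\<lambda>x. c)"
proof (rule smooth_on_coinduct[OF assms, where P = "\<lambda>f. \<exists>c. f = (\<lambda>x. c)"])
  fix f :: "'a \<Rightarrow> 'b" assume "\<exists>c. f = (\<lambda>x. c)"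
  then show "\<exists>D. (\<forall>x\<in>S. (f has_derivative D x) (at x)) \<and> (\<forall>e\<in>Basis. \<exists>c. (\<lambda>x. D x e) = (\<lambda>x. c))"
    by (intro exI[of _ "\<lambda>x h. 0"]) auto
qed blast

lemma smooth_on_bounded_linear:
  assumes "open S" and "bounded_linear L"
  shows "smooth_on S L"
proof (rule smooth_on_coinduct[OF assms(1), where P = "\<lambda>f. f = L \<or> (\<exists>c. f = (\<lambda>x. c))"])
  fix f :: "'a \<Rightarrow> 'b" assume "f = L \<or> (\<exists>c. f = (\<lambda>x. c))"
  then show "\<exists>D. (\<forall>x\<in>S. (f has_derivative D x) (at x)) \<and>
      (\<forall>e\<in>Basis. (\<lambda>x. D x e) = L \<or> (\<exists>c. (\<lambda>x. D x e) = (\<lambda>x. c)))"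
  proof
    assume "f = L"
    then show ?thesis
      using bounded_linear_imp_has_derivative[OF assms(2)] by (intro exI[of _ "\<lambda>x. L"]) auto
  next
    assume "\<exists>c. f = (\<lambda>x. c)"
    then show ?thesis by (intro exI[of _ "\<lambda>x h. 0"]) auto
  qed
qed simp

lemma smooth_on_add:
  assumes "open S" and "smooth_on S f" and "smooth_on S g"
  shows "smooth_on S (\<lambda>x. f x + g x)"
proof (rule smooth_on_coinduct[OF assms(1),
      where P = "\<lambda>h. \<exists>f g. smooth_on S f \<and> smooth_on S g \<and> h = (\<lambda>x. f x + g x)"])
  fix h :: "'a \<Rightarrow> 'b"
  assume "\<exists>f g. smooth_on S f \<and> smooth_on S g \<and> h = (\<lambda>x. f x + g x)"
  then obtain f g where fg: "smooth_on S f" "smooth_on S g" and h: "h = (\<lambda>x. f x + g x)" by blast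
  let ?D = "\<lambda>x d. frechet_derivative f (at x) d + frechet_derivative g (at x) d"
  have "(h has_derivative ?D x) (at x)" if "x \<in> S" for x
    unfolding h using fg that by (intro has_derivative_add smooth_on_has_derivative)
  moreover have "(\<lambda>x. ?D x e) = (\<lambda>x. partial_deriv e f x + partial_deriv e g x)" for e
    by (simp add: partial_deriv_def)
  ultimately show "\<exists>D. (\<forall>x\<in>S. (h has_derivative D x) (at x)) \<and>
      (\<forall>e\<in>Basis. \<exists>f g. smooth_on S f \<and> smooth_on S g \<and> (\<lambda>x. D x e) = (\<lambda>x. f x + g x))"
    using fg smooth_on_partial_deriv by (intro exI[of _ ?D]) blast
qed (use assms in blast)

text \<open>
  The product rule turns one product into a sum of two, so the family containing all iterated
  derivatives of a product consists of the finite sums of products.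
\<close>

inductive sum_of_scaled_smooth ::
  "'a::euclidean_space set \<Rightarrow> ('a \<Rightarrow> 'b::real_normed_vector) \<Rightarrow> bool" for S where
  scaled: "smooth_on S r \<Longrightarrow> smooth_on S f \<Longrightarrow> sum_of_scaled_smooth S (\<lambda>x. r x *\<^sub>R f x)"
| plus: "sum_of_scaled_smooth S f \<Longrightarrow> sum_of_scaled_smooth S g
    \<Longrightarrow> sum_of_scaled_smooth S (\<lambda>x. f x + g x)"

lemma smooth_on_scaleR:
  assumes "open S" and "smooth_on S r" and "smooth_on S f"
  shows "smooth_on S (\<lambda>x. r x *\<^sub>R f x)"
proof (rule smooth_on_coinduct[OF assms(1), where P = "sum_of_scaled_smooth S"])
  fix h :: "'a \<Rightarrow> 'b" assume "sum_of_scaled_smooth S h"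
  then show "\<exists>D. (\<forall>x\<in>S. (h has_derivative D x) (at x)) \<and>
      (\<forall>e\<in>Basis. sum_of_scaled_smooth S (\<lambda>x. D x e))"
  proof induction
    case (scaled r f)
    let ?D = "\<lambda>x d. r x *\<^sub>R frechet_derivative f (at x) d + frechet_derivative r (at x) d *\<^sub>R f x"
    have "((\<lambda>x. r x *\<^sub>R f x) has_derivative ?D x) (at x)" if "x \<in> S" for x
      using scaled that by (intro has_derivative_scaleR smooth_on_has_derivative)
    moreover have "sum_of_scaled_smooth S (\<lambda>x. ?D x e)" if "e \<in> Basis" for e
      using sum_of_scaled_smooth.plus[OF
          sum_of_scaled_smooth.scaled[OF scaled(1) smooth_on_partial_deriv[OF scaled(2) that]]
          sum_of_scaled_smooth.scaled[OF smooth_on_partial_deriv[OF scaled(1) that] scaled(2)]]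
      by (simp add: partial_deriv_def)
    ultimately show ?case by (intro exI[of _ ?D]) blast
  next
    case (plus f g)
    then obtain D D' where
      D: "\<forall>x\<in>S. (f has_derivative D x) (at x)" "\<forall>e\<in>Basis. sum_of_scaled_smooth S (\<lambda>x. D x e)" and
      D': "\<forall>x\<in>S. (g has_derivative D' x) (at x)" "\<forall>e\<in>Basis. sum_of_scaled_smooth S (\<lambda>x. D' x e)"
      by blast
    then show ?case
      by (intro exI[of _ "\<lambda>x d. D x d + D' x d"])
        (auto intro: has_derivative_add sum_of_scaled_smooth.plus)
  qed
qed (use assms in \<open>blast intro: scaled\<close>)

lemma smooth_on_mult:
  fixes f g :: "'a::euclidean_space \<Rightarrow> real"
  assumes "open S" and "smooth_on S f" and "smooth_on S g"
  shows "smooth_on S (\<lambda>x. f x * g x)"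
  using smooth_on_scaleR[OF assms] by simp

lemma frechet_derivative_eq_partial_deriv:
  fixes h :: "real \<Rightarrow> 'b::real_normed_vector"
  assumes "smooth_on J h" and "t \<in> J"
  shows "frechet_derivative h (at t) d = d *\<^sub>R partial_deriv 1 h t"
proof -
  have "linear (frechet_derivative h (at t))"
    using smooth_on_has_derivative[OF assms] has_derivative_linear by blast
  from linear_scale[OF this, of d 1] show ?thesis by (simp add: partial_deriv_def)
qed

text \<open>
  For a linear functional \<open>L\<close> the derivative of \<open>h \<circ> L\<close> in direction \<open>e\<close> is \<open>(L e \<cdot> h') \<circ> L\<close>, again a
  smooth function after \<open>L\<close>; so the family of all such composites is closed.
\<close>

lemma smooth_on_compose_functional:
  fixes L :: "'a::euclidean_space \<Rightarrow> real"
  assumes "open S" and "open J" and L: "bounded_linear L" and LS: "\<And>x. x \<in> S \<Longrightarrow> L x \<in> J"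
    and "smooth_on J h"
  shows "smooth_on S (\<lambda>x. h (L x))"
proof -
  let ?P = "\<lambda>f. \<exists>h. smooth_on J h \<and> f = (\<lambda>x. h (L x))"
  show ?thesis
  proof (rule smooth_on_coinduct[OF assms(1), where P = ?P])
    fix f :: "'a \<Rightarrow> 'b" assume "?P f"
    then obtain h where h: "smooth_on J h" and f: "f = (\<lambda>x. h (L x))" by blast
    let ?D = "\<lambda>x d. L d *\<^sub>R partial_deriv 1 h (L x)"
    have "(f has_derivative ?D x) (at x)" if x: "x \<in> S" for x
    proof -
      have "((h \<circ> L) has_derivative (frechet_derivative h (at (L x)) \<circ> L)) (at x)"
        using bounded_linear_imp_has_derivative[OF L] smooth_on_has_derivative[OF h LS[OF x]]
        by (rule diff_chain_at)
      then show ?thesis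
        by (simp add: f comp_def frechet_derivative_eq_partial_deriv[OF h LS[OF x]])
    qed
    moreover have "smooth_on J (\<lambda>t. L e *\<^sub>R partial_deriv 1 h t)" for e
      by (intro smooth_on_scaleR smooth_on_const smooth_on_partial_deriv h assms(2)) simp
    ultimately show "\<exists>D. (\<forall>x\<in>S. (f has_derivative D x) (at x)) \<and> (\<forall>e\<in>Basis. ?P (\<lambda>x. D x e))"
      by (intro exI[of _ ?D]) blast
  qed (use assms in blast)
qed

text \<open>Unlike sine or cosine alone, their linear combinations form a closed family.\<close>

lemma smooth_on_sin_cos_combination:
  assumes "open S"
  shows "smooth_on S (\<lambda>t::real. A * sin t + B * cos t)"
proof (rule smooth_on_coinduct[OF assms,
      where P = "\<lambda>f. \<exists>A B. f = (\<lambda>t. A * sin t + B * cos t)"])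
  fix f :: "real \<Rightarrow> real" assume "\<exists>A B. f = (\<lambda>t. A * sin t + B * cos t)"
  then obtain A B where f: "f = (\<lambda>t. A * sin t + B * cos t)" by blast
  let ?D = "\<lambda>x d. d * (A * cos x - B * sin x)"
  have "(f has_derivative ?D x) (at x)" for x
    unfolding f by (auto intro!: derivative_eq_intros simp: algebra_simps)
  moreover have "(\<lambda>x. ?D x e) = (\<lambda>t. (- e * B) * sin t + (e * A) * cos t)" for e
    by (auto simp: algebra_simps)
  ultimately show "\<exists>D. (\<forall>x\<in>S. (f has_derivative D x) (at x)) \<and>
      (\<forall>e\<in>Basis. \<exists>A B. (\<lambda>x. D x e) = (\<lambda>t. A * sin t + B * cos t))"
    by (intro exI[of _ ?D]) blast
qed blast

lemma smooth_on_real_derivs: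
  fixes f :: "real \<Rightarrow> real"
  assumes "open J" and "smooth_on J f" and "t \<in> J"
  shows "(f has_field_derivative deriv f t) (at t)"
    and "(deriv f has_field_derivative deriv (deriv f) t) (at t)"
proof -
  have D: "(h has_field_derivative partial_deriv 1 h s) (at s)"
    if "smooth_on J h" "s \<in> J" for h :: "real \<Rightarrow> real" and s
  proof -
    have "frechet_derivative h (at s) = (*) (partial_deriv 1 h s)"
      using frechet_derivative_eq_partial_deriv[OF that] by auto
    then show ?thesis
      using smooth_on_has_derivative[OF that] by (simp add: has_field_derivative_def)
  qed
  have eq: "partial_deriv 1 f s = deriv f s" if "s \<in> J" for s
    using D[OF assms(2) that] by (simp add: DERIV_imp_deriv)
  show "(f has_field_derivative deriv f t) (at t)"
    using D[OF assms(2,3)] eq[OF assms(3)] by simp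
  have "(partial_deriv 1 f has_field_derivative partial_deriv 1 (partial_deriv 1 f) t) (at t)"
    using smooth_on_partial_deriv[OF assms(2)] assms(3) by (intro D) auto
  then have "(deriv f has_field_derivative partial_deriv 1 (partial_deriv 1 f) t) (at t)"
    using eq has_field_derivative_transform_within_open[OF _ assms(1,3)] by fastforce
  then show "(deriv f has_field_derivative deriv (deriv f) t) (at t)"
    using DERIV_imp_deriv by fastforce
qed

text \<open>
  The coefficients of the metric and the tangent frame have explicit formulas only on the domain of
  the surface; because that domain is open, they may be differentiated through these formulas.
\<close>

lemma partial_deriv_eq:
  assumes "open U" and "p \<in> U" and "\<And>q. q \<in> U \<Longrightarrow> f q = g q"
    and "(g has_derivative D) (at p)"
  shows "partial_deriv e f p = D e"
proof -
  have "(f has_derivative D) (at p)"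
    using has_derivative_transform_within_open[OF assms(4,1,2)] assms(3) by simp
  then show ?thesis
    by (simp add: partial_deriv_def frechet_derivative_at[symmetric])
qed

lemma has_vector_derivative_of_constant_on:
  assumes "(f has_vector_derivative d) (at t)" and "open J" and "t \<in> J"
    and "\<And>s. s \<in> J \<Longrightarrow> f s = k"
  shows "d = 0"
proof -
  have "((\<lambda>s. k) has_vector_derivative d) (at t)"
    using has_vector_derivative_transform_within_open[OF assms(1-3)] assms(4) by simp
  then show ?thesis using vector_derivative_unique_at has_vector_derivative_const by blast
qed

section \<open>The Minkowski product and diagonal metrics\<close>

lemma bounded_bilinear_mink: "bounded_bilinear mink"
proof -
  have "bilinear mink"
    unfolding bilinear_def by (auto intro!: linearI simp: mink_def algebra_simps)
  then show ?thesis by (simp add: bilinear_conv_bounded_bilinear)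
qed

interpretation mink: bounded_bilinear mink
  by (rule bounded_bilinear_mink)

lemma mink_commute: "mink x y = mink y x"
  by (simp add: mink_def mult.commute)

lemmas mink_expand =
  mink.add_left mink.add_right mink.diff_left mink.diff_right mink.scaleR_left mink.scaleR_right

text \<open>
  In the frame \<open>e\<^sub>1, e\<^sub>2, \<xi>\<^sub>1, \<xi>\<^sub>2\<close>, vectors without \<open>\<xi>\<^sub>2\<close> component multiply as their projections to
  the Euclidean plane do.
\<close>

lemma mink_null_frame:
  "mink (x *\<^sub>R e1 + y *\<^sub>R e2 + s *\<^sub>R xi1 + t *\<^sub>R xi2)
        (x' *\<^sub>R e1 + y' *\<^sub>R e2 + s' *\<^sub>R xi1 + t' *\<^sub>R xi2)
    = x * x' + y * y' - s * t' - t * s'"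
  by (simp add: mink_def xi1_def xi2_def axis_def field_simps)

lemma matrix_inv_unique:
  fixes A B :: "real^'n^'n"
  assumes "A ** B = mat 1" and "B ** A = mat 1"
  shows "matrix_inv A = B"
proof -
  have "A ** matrix_inv A = mat 1 \<and> matrix_inv A ** A = mat 1"
    unfolding matrix_inv_def by (rule someI[of _ B]) (use assms in simp)
  then show ?thesis
    by (metis assms(1) matrix_mul_assoc matrix_mul_lid matrix_mul_rid)
qed

lemma matrix_inv_diagonal_2:
  fixes A :: "real^2^2"
  assumes "A $ 1 $ 1 \<noteq> 0" and "A $ 2 $ 2 \<noteq> 0" and "A $ 1 $ 2 = 0" and "A $ 2 $ 1 = 0"
  shows "matrix_inv A = (\<chi> i j. if i = j then 1 / A $ i $ i else 0)"
  using assms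
  by (intro matrix_inv_unique)
    (simp_all add: vec_eq_iff forall_2 matrix_matrix_mult_def sum_2 mat_def)

section \<open>Ruled surfaces over a curve on the light cone\<close>

text \<open>
  The curve \<open>c\<close> lies on the slice \<open>\<langle>c, n\<rangle> = -1\<close> of the light cone, which is a paraboloid. The functions
  \<open>c'\<close> and \<open>c''\<close> name its first two derivatives, so that concrete formulas can be supplied for them.
\<close>

locale null_curve_surface =
  fixes n :: "real^4" and c c' c'' :: "real \<Rightarrow> real^4" and a b :: real and I J :: "real set"
  assumes a_neg: "a < 0" and open_I: "open I" and pos_I: "I \<subseteq> {0<..}" and open_J: "open J"
    and smooth_c: "smooth_on J c"
    and c_deriv: "v \<in> J \<Longrightarrow> (c has_vector_derivative c' v) (at v)"
    and c'_deriv: "v \<in> J \<Longrightarrow> (c' has_vector_derivative c'' v) (at v)"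
    and n_null: "mink n n = 0"
    and c_null: "v \<in> J \<Longrightarrow> mink (c v) (c v) = 0"
    and c_n: "v \<in> J \<Longrightarrow> mink (c v) n = - 1"
    and regular: "v \<in> J \<Longrightarrow> 0 < mink (c' v) (c' v)"
begin

definition z :: "real^2 \<Rightarrow> real^4" where
  "z p = (p $ 1) *\<^sub>R c (p $ 2) + (a * p $ 1 + b) *\<^sub>R n"

definition U :: "(real^2) set" where
  "U = {p. p $ 1 \<in> I \<and> p $ 2 \<in> J}"

lemma open_U: "open U"
proof -
  have "U = ((\<lambda>p. p $ 1) -` I) \<inter> ((\<lambda>p. p $ 2) -` J)" by (auto simp: U_def)
  then show ?thesis
    by (simp add: open_Int open_I open_J open_vimage continuous_on_component)
qed

lemma U_D: "p \<in> U \<Longrightarrow> 0 < p $ 1" "p \<in> U \<Longrightarrow> p $ 2 \<in> J"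
  using pos_I by (auto simp: U_def)

text \<open>Differentiating the relations \<open>\<langle>c, c\<rangle> = 0\<close> and \<open>\<langle>c, n\<rangle> = -1\<close> yields the next four products.\<close>

lemma mink_c_c': "v \<in> J \<Longrightarrow> mink (c v) (c' v) = 0"
  using has_vector_derivative_of_constant_on[OF
      mink.has_vector_derivative[OF c_deriv c_deriv] open_J, of v] c_null
  by (auto simp: mink_commute)

lemma mink_c'_n: "v \<in> J \<Longrightarrow> mink (c' v) n = 0"
  using has_vector_derivative_of_constant_on[OF
      mink.has_vector_derivative[OF c_deriv has_vector_derivative_const[of n]] open_J, of v] c_n
  by (auto simp: mink.zero_right)

lemma mink_c''_n: "v \<in> J \<Longrightarrow> mink (c'' v) n = 0"
  using has_vector_derivative_of_constant_on[OF
      mink.has_vector_derivative[OF c'_deriv has_vector_derivative_const[of n]] open_J, of v]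
    mink_c'_n
  by (auto simp: mink.zero_right)

lemma mink_c_c'': "v \<in> J \<Longrightarrow> mink (c v) (c'' v) = - mink (c' v) (c' v)"
  using has_vector_derivative_of_constant_on[OF
      mink.has_vector_derivative[OF c_deriv c'_deriv] open_J, of v, where k = 0] mink_c_c'
  by auto

lemmas mink_facts =
  n_null c_null c_n mink_c_c' mink_c'_n mink_c''_n mink_c_c''
  mink_commute[of n "c v" for v] mink_commute[of n "c' v" for v] mink_commute[of n "c'' v" for v]
  mink_commute[of "c' v" "c v" for v] mink_commute[of "c'' v" "c v" for v]
  mink_commute[of "c'' v" "c' v" for v]

lemma has_derivative_along_v:
  fixes h :: "real \<Rightarrow> 'b::real_normed_vector"
  assumes "(h has_vector_derivative d) (at (p $ 2))"
  shows "((\<lambda>q::real^2. h (q $ 2)) has_derivative (\<lambda>e. (e $ 2) *\<^sub>R d)) (at p)"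
proof -
  have "((\<lambda>q::real^2. q $ 2) has_derivative (\<lambda>e. e $ 2)) (at p)"
    by (intro bounded_linear_imp_has_derivative bounded_linear_vec_nth)
  from diff_chain_at[OF this assms[unfolded has_vector_derivative_def]]
  show ?thesis by (simp add: comp_def)
qed

lemma has_derivative_u: "((\<lambda>q::real^2. q $ 1) has_derivative (\<lambda>e. e $ 1)) (at p)"
  by (intro bounded_linear_imp_has_derivative bounded_linear_vec_nth)

lemma z_has_derivative:
  assumes "p \<in> U"
  shows "(z has_derivative
    (\<lambda>e. (e $ 1) *\<^sub>R (c (p $ 2) + a *\<^sub>R n) + (e $ 2) *\<^sub>R (p $ 1) *\<^sub>R c' (p $ 2))) (at p)"
  unfolding z_def[abs_def]
  by (rule has_derivative_eq_rhs[OF has_derivative_add[OF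
        has_derivative_scaleR[OF has_derivative_u
          has_derivative_along_v[OF c_deriv[OF U_D(2)[OF assms]]]]
        has_derivative_scaleR[OF has_derivative_add[OF
            has_derivative_mult_right[OF has_derivative_u] has_derivative_const]
          has_derivative_const]]])
    (simp add: algebra_simps)

lemma tangent_map_z:
  assumes "p \<in> U"
  shows "tangent_map z p e =
    (e $ 1) *\<^sub>R (c (p $ 2) + a *\<^sub>R n) + (e $ 2) *\<^sub>R (p $ 1) *\<^sub>R c' (p $ 2)"
  unfolding tangent_map_def frechet_derivative_at[OF z_has_derivative[OF assms], symmetric] ..

lemma induced_metric_z:
  assumes "p \<in> U"
  shows "induced_metric z p x y =
    - 2 * a * (x $ 1) * (y $ 1) + (p $ 1)\<^sup>2 * mink (c' (p $ 2)) (c' (p $ 2)) * (x $ 2) * (y $ 2)"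
  using U_D(2)[OF assms]
  by (simp add: induced_metric_def tangent_map_z[OF assms] mink_expand mink_facts
      algebra_simps power2_eq_square)

lemma smooth_z: "smooth_on U z"
proof -
  have c: "smooth_on U (\<lambda>p. c (p $ 2))"
    by (rule smooth_on_compose_functional[OF open_U open_J bounded_linear_vec_nth U_D(2) smooth_c])
  have u: "smooth_on U (\<lambda>p. p $ 1)"
    by (intro smooth_on_bounded_linear open_U bounded_linear_vec_nth)
  show ?thesis
    unfolding z_def[abs_def]
    by (intro smooth_on_add smooth_on_scaleR smooth_on_mult smooth_on_const open_U c u)
qed

lemma spacelike_z: "spacelike_surface z U"
  unfolding spacelike_surface_def
proof (intro conjI ballI allI impI open_U smooth_z)
  fix p x assume p: "p \<in> U" and x: "(x :: real^2) \<noteq> 0"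
  have E: "0 < - 2 * a" using a_neg by simp
  have G: "0 < (p $ 1)\<^sup>2 * mink (c' (p $ 2)) (c' (p $ 2))"
    using U_D[OF p] regular by simp
  consider "x $ 1 \<noteq> 0" | "x $ 2 \<noteq> 0"
    using x by (auto simp: vec_eq_iff forall_2)
  then have "0 < (- 2 * a) * (x $ 1)\<^sup>2 + (p $ 1)\<^sup>2 * mink (c' (p $ 2)) (c' (p $ 2)) * (x $ 2)\<^sup>2"
  proof cases
    case 1
    then have "0 < (- 2 * a) * (x $ 1)\<^sup>2" using mult_pos_pos[OF E, of "(x $ 1)\<^sup>2"] by simp
    then show ?thesis using mult_nonneg_nonneg[OF less_imp_le[OF G] zero_le_power2] by (rule add_pos_nonneg)
  next
    case 2
    then have "0 < (p $ 1)\<^sup>2 * mink (c' (p $ 2)) (c' (p $ 2)) * (x $ 2)\<^sup>2"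
      using mult_pos_pos[OF G, of "(x $ 2)\<^sup>2"] by simp
    with mult_nonneg_nonneg[OF less_imp_le[OF E] zero_le_power2] show ?thesis by (rule add_nonneg_pos)
  qed
  then show "0 < induced_metric z p x x"
    by (simp add: induced_metric_z[OF p] power2_eq_square mult.assoc)
qed

lemma metric_matrix_z:
  assumes "p \<in> U"
  shows "metric_matrix z p $ 1 $ 1 = - 2 * a" "metric_matrix z p $ 1 $ 2 = 0"
    "metric_matrix z p $ 2 $ 1 = 0"
    "metric_matrix z p $ 2 $ 2 = (p $ 1)\<^sup>2 * mink (c' (p $ 2)) (c' (p $ 2))"
  by (simp_all add: metric_matrix_def induced_metric_z[OF assms] axis_def)

lemma inverse_metric_z:
  assumes "p \<in> U"
  shows "matrix_inv (metric_matrix z p) $ 1 $ 1 = - 1 / (2 * a)"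
    "matrix_inv (metric_matrix z p) $ 1 $ 2 = 0" "matrix_inv (metric_matrix z p) $ 2 $ 1 = 0"
    "matrix_inv (metric_matrix z p) $ 2 $ 2 = 1 / ((p $ 1)\<^sup>2 * mink (c' (p $ 2)) (c' (p $ 2)))"
  using a_neg U_D(1)[OF assms] regular[OF U_D(2)[OF assms]]
  by (simp_all add: matrix_inv_diagonal_2 metric_matrix_z[OF assms])

lemma partial_deriv_metric_z:
  assumes "p \<in> U"
  shows "partial_deriv e (\<lambda>q. metric_matrix z q $ 1 $ 1) p = 0"
    "partial_deriv e (\<lambda>q. metric_matrix z q $ 1 $ 2) p = 0"
    "partial_deriv e (\<lambda>q. metric_matrix z q $ 2 $ 1) p = 0"
    "partial_deriv e (\<lambda>q. metric_matrix z q $ 2 $ 2) p =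
      2 * p $ 1 * e $ 1 * mink (c' (p $ 2)) (c' (p $ 2))
      + 2 * (p $ 1)\<^sup>2 * e $ 2 * mink (c' (p $ 2)) (c'' (p $ 2))"
proof -
  have const: "partial_deriv e (\<lambda>q. metric_matrix z q $ i $ j) p = 0"
    if "\<And>q. q \<in> U \<Longrightarrow> metric_matrix z q $ i $ j = k" for i j k
    using partial_deriv_eq[OF open_U assms that has_derivative_const] by simp
  show "partial_deriv e (\<lambda>q. metric_matrix z q $ 1 $ 1) p = 0"
    "partial_deriv e (\<lambda>q. metric_matrix z q $ 1 $ 2) p = 0"
    "partial_deriv e (\<lambda>q. metric_matrix z q $ 2 $ 1) p = 0"
    by (rule const[OF metric_matrix_z(1)] const[OF metric_matrix_z(2)] const[OF metric_matrix_z(3)],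
        assumption)+
  have w: "((\<lambda>v. mink (c' v) (c' v)) has_vector_derivative
      2 * mink (c' (p $ 2)) (c'' (p $ 2))) (at (p $ 2))"
    using mink.has_vector_derivative[OF c'_deriv c'_deriv, OF U_D(2)[OF assms] U_D(2)[OF assms]]
    by (simp add: mink_facts)
  have "((\<lambda>q. (q $ 1)\<^sup>2 * mink (c' (q $ 2)) (c' (q $ 2))) has_derivative
      (\<lambda>e. 2 * p $ 1 * e $ 1 * mink (c' (p $ 2)) (c' (p $ 2))
        + 2 * (p $ 1)\<^sup>2 * e $ 2 * mink (c' (p $ 2)) (c'' (p $ 2)))) (at p)"
    by (rule has_derivative_eq_rhs[OF has_derivative_mult[OF
          has_derivative_power[OF has_derivative_u] has_derivative_along_v[OF w]]])
      (simp add: algebra_simps)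
  from partial_deriv_eq[OF open_U assms metric_matrix_z(4) this]
  show "partial_deriv e (\<lambda>q. metric_matrix z q $ 2 $ 2) p =
      2 * p $ 1 * e $ 1 * mink (c' (p $ 2)) (c' (p $ 2))
      + 2 * (p $ 1)\<^sup>2 * e $ 2 * mink (c' (p $ 2)) (c'' (p $ 2))" .
qed

text \<open>
  The tangent vector \<open>z\<^sub>u = c + a n\<close> does not change along a ruling, and the Christoffel symbols
  \<open>\<Gamma>\<^sup>k\<^sub>1\<^sub>1\<close> vanish because \<open>E\<close> is constant and \<open>F = 0\<close>.
\<close>

lemma second_fundamental_uu:
  assumes "p \<in> U"
  shows "second_fundamental z (\<lambda>_. axis 1 1) (\<lambda>_. axis 1 1) p = 0"
proof -
  have "((\<lambda>q. c (q $ 2) + a *\<^sub>R n) has_derivative (\<lambda>e. (e $ 2) *\<^sub>R c' (p $ 2))) (at p)"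
    using has_derivative_add[OF has_derivative_along_v[OF c_deriv[OF U_D(2)[OF assms]]]
        has_derivative_const] by simp
  then have "ambient_connection z (\<lambda>_. axis 1 1) (\<lambda>_. axis 1 1) p = 0"
    using partial_deriv_eq[OF open_U assms, of "\<lambda>q. tangent_map z q (axis 1 1)"
        "\<lambda>q. c (q $ 2) + a *\<^sub>R n" _ "axis 1 1"]
    by (simp add: ambient_connection_def tangent_map_z partial_deriv_def axis_def)
  moreover have "levi_civita z (\<lambda>_. axis 1 1) (\<lambda>_. axis 1 1) p = 0"
    by (simp add: vec_eq_iff forall_2 levi_civita_def christoffel_def sum_2
        partial_deriv_metric_z[OF assms] inverse_metric_z[OF assms] axis_def)
  ultimately show ?thesis
    by (simp add: second_fundamental_def tangent_map_z[OF assms])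
qed

text \<open>
  The subtracted terms are the tangential part of \<open>z\<^sub>v\<^sub>v = u c''\<close>. Their coefficients come from the
  Christoffel symbols \<open>\<Gamma>\<^sup>1\<^sub>2\<^sub>2 = - G\<^sub>u / (2 E) = u w / (2 a)\<close> and
  \<open>\<Gamma>\<^sup>2\<^sub>2\<^sub>2 = G\<^sub>v / (2 G) = \<langle>c', c''\<rangle> / w\<close>.
\<close>

lemma second_fundamental_vv:
  assumes "p \<in> U"
  defines "u \<equiv> p $ 1" and "v \<equiv> p $ 2"
  defines "w \<equiv> mink (c' v) (c' v)"
  shows "second_fundamental z (\<lambda>_. axis 2 1) (\<lambda>_. axis 2 1) p =
    u *\<^sub>R (c'' v - (w / (2 * a)) *\<^sub>R (c v + a *\<^sub>R n) - (mink (c' v) (c'' v) / w) *\<^sub>R c' v)"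
proof -
  note pos = a_neg U_D(1)[OF assms(1)] regular[OF U_D(2)[OF assms(1)]]
  have "((\<lambda>q. (q $ 1) *\<^sub>R c' (q $ 2)) has_derivative
      (\<lambda>e. (e $ 1) *\<^sub>R c' v + (e $ 2) *\<^sub>R u *\<^sub>R c'' v)) (at p)"
    unfolding u_def v_def
    by (rule has_derivative_eq_rhs[OF has_derivative_scaleR[OF has_derivative_u
          has_derivative_along_v[OF c'_deriv[OF U_D(2)[OF assms(1)]]]]])
      (simp add: algebra_simps)
  then have "ambient_connection z (\<lambda>_. axis 2 1) (\<lambda>_. axis 2 1) p = u *\<^sub>R c'' v"
    using partial_deriv_eq[OF open_U assms(1), of "\<lambda>q. tangent_map z q (axis 2 1)"
        "\<lambda>q. (q $ 1) *\<^sub>R c' (q $ 2)" _ "axis 2 1"]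
    by (simp add: ambient_connection_def tangent_map_z partial_deriv_def axis_def)
  moreover have "levi_civita z (\<lambda>_. axis 2 1) (\<lambda>_. axis 2 1) p $ 1 = u * w / (2 * a)"
    "levi_civita z (\<lambda>_. axis 2 1) (\<lambda>_. axis 2 1) p $ 2 = mink (c' v) (c'' v) / w"
    using pos unfolding u_def v_def w_def
    by (simp_all add: levi_civita_def christoffel_def sum_2 power2_eq_square field_simps
        partial_deriv_metric_z[OF assms(1)] inverse_metric_z[OF assms(1)] axis_def)
  ultimately show ?thesis
    by (simp add: second_fundamental_def tangent_map_z[OF assms(1)] u_def v_def algebra_simps)
qed

lemma mean_curvature_vector_z:
  assumes "p \<in> U"
  defines "u \<equiv> p $ 1" and "v \<equiv> p $ 2"
  defines "w \<equiv> mink (c' v) (c' v)"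
  shows "mean_curvature_vector z p = (1 / (2 * u * w)) *\<^sub>R
    (c'' v - (w / (2 * a)) *\<^sub>R (c v + a *\<^sub>R n) - (mink (c' v) (c'' v) / w) *\<^sub>R c' v)"
  using U_D(1)[OF assms(1)] unfolding u_def v_def w_def
  by (simp add: mean_curvature_vector_def sum_2 inverse_metric_z[OF assms(1)]
      second_fundamental_uu[OF assms(1)] second_fundamental_vv[OF assms(1)] power2_eq_square)

text \<open>
  The left-hand side of the criterion is the Gram determinant of \<open>c'\<close> and \<open>c''\<close>. The parameter \<open>u\<close>
  has dropped out, because \<open>H\<close> depends on it only through a positive factor.
\<close>

lemma lightlike_mean_curvature_iff:
  assumes "p \<in> U"
  defines "v \<equiv> p $ 2"
  defines "w \<equiv> mink (c' v) (c' v)"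
  shows "lightlike (mean_curvature_vector z p) \<longleftrightarrow>
    w * mink (c'' v) (c'' v) - (mink (c' v) (c'' v))\<^sup>2 = - (w ^ 3 / (2 * a))"
proof -
  define N where
    "N = c'' v - (w / (2 * a)) *\<^sub>R (c v + a *\<^sub>R n) - (mink (c' v) (c'' v) / w) *\<^sub>R c' v"
  have v: "v \<in> J" using U_D(2)[OF assms(1)] by (simp add: v_def)
  have w: "w > 0" using regular[OF v] by (simp add: w_def)
  \<comment> \<open>Only the \<open>c\<close> term of \<open>N\<close> has a nonzero product with \<open>n\<close>, so \<open>N\<close> cannot vanish.\<close>
  have "mink N n = w / (2 * a)"
    using a_neg by (simp add: N_def mink_expand mink_facts v)
  then have nz: "N \<noteq> 0" using w a_neg by (auto simp: mink.zero_left)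
  have "mink N N = mink (c'' v) (c'' v) - (mink (c' v) (c'' v))\<^sup>2 / w + w\<^sup>2 / (2 * a)"
    using a_neg w unfolding N_def
    by (simp add: mink_expand mink_facts v w_def[symmetric] power2_eq_square field_simps)
  then have "w * mink N N =
      w * mink (c'' v) (c'' v) - (mink (c' v) (c'' v))\<^sup>2 + w ^ 3 / (2 * a)"
    using w by (simp add: field_simps power2_eq_square power3_eq_cube)
  moreover have "mean_curvature_vector z p = (1 / (2 * p $ 1 * w)) *\<^sub>R N"
    using mean_curvature_vector_z[OF assms(1)] by (simp add: N_def v_def w_def)
  ultimately show ?thesis
    using w nz U_D(1)[OF assms(1)] by (auto simp: lightlike_def mink_expand)
qed

end

section \<open>Meridian surfaces of parabolic type\<close>

text \<open>
  The lift of the plane polar curve with radius \<open>\<phi>\<close> to the light cone. Zero and unit coefficients of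
  \<open>\<xi>\<^sub>2\<close> are kept explicit here and below so that all vectors have the shape of \<open>mink_null_frame\<close>.
\<close>

definition paraboloid_curve :: "(real \<Rightarrow> real) \<Rightarrow> real \<Rightarrow> real^4" where
  "paraboloid_curve \<phi> v =
    (\<phi> v * cos v) *\<^sub>R e1 + (\<phi> v * sin v) *\<^sub>R e2 + ((\<phi> v)\<^sup>2 / 2) *\<^sub>R xi1 + 1 *\<^sub>R xi2"

lemma paraboloid_curve_derivs:
  assumes "(\<phi> has_field_derivative \<phi>' v) (at v)" and "(\<phi>' has_field_derivative \<phi>'') (at v)"
  shows "(paraboloid_curve \<phi> has_vector_derivative
      (\<phi>' v * cos v - \<phi> v * sin v) *\<^sub>R e1 + (\<phi>' v * sin v + \<phi> v * cos v) *\<^sub>R e2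
      + (\<phi> v * \<phi>' v) *\<^sub>R xi1 + 0 *\<^sub>R xi2) (at v)"
    and "((\<lambda>v. (\<phi>' v * cos v - \<phi> v * sin v) *\<^sub>R e1 + (\<phi>' v * sin v + \<phi> v * cos v) *\<^sub>R e2
      + (\<phi> v * \<phi>' v) *\<^sub>R xi1 + 0 *\<^sub>R xi2) has_vector_derivative
      (\<phi>'' * cos v - 2 * \<phi>' v * sin v - \<phi> v * cos v) *\<^sub>R e1
      + (\<phi>'' * sin v + 2 * \<phi>' v * cos v - \<phi> v * sin v) *\<^sub>R e2
      + (\<phi> v * \<phi>'' + (\<phi>' v)\<^sup>2) *\<^sub>R xi1 + 0 *\<^sub>R xi2) (at v)"
proof -
  have lin: "((\<lambda>v. f v *\<^sub>R x) has_vector_derivative (f' *\<^sub>R x)) (at v)"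
    if "(f has_field_derivative f') (at v)" for f f' v and x :: "real^4"
    using has_vector_derivative_scaleR[OF that has_vector_derivative_const] by simp
  show "(paraboloid_curve \<phi> has_vector_derivative
      (\<phi>' v * cos v - \<phi> v * sin v) *\<^sub>R e1 + (\<phi>' v * sin v + \<phi> v * cos v) *\<^sub>R e2
      + (\<phi> v * \<phi>' v) *\<^sub>R xi1 + 0 *\<^sub>R xi2) (at v)"
    unfolding paraboloid_curve_def[abs_def]
    by (intro has_vector_derivative_add lin)
      (rule derivative_eq_intros assms refl | simp add: algebra_simps)+
  show "((\<lambda>v. (\<phi>' v * cos v - \<phi> v * sin v) *\<^sub>R e1 + (\<phi>' v * sin v + \<phi> v * cos v) *\<^sub>R e2
      + (\<phi> v * \<phi>' v) *\<^sub>R xi1 + 0 *\<^sub>R xi2) has_vector_derivative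
      (\<phi>'' * cos v - 2 * \<phi>' v * sin v - \<phi> v * cos v) *\<^sub>R e1
      + (\<phi>'' * sin v + 2 * \<phi>' v * cos v - \<phi> v * sin v) *\<^sub>R e2
      + (\<phi> v * \<phi>'' + (\<phi>' v)\<^sup>2) *\<^sub>R xi1 + 0 *\<^sub>R xi2) (at v)"
    by (intro has_vector_derivative_add lin)
      (rule derivative_eq_intros assms refl | simp add: algebra_simps power2_eq_square)+
qed

lemma smooth_paraboloid_curve:
  assumes "open J" and "smooth_on J \<phi>"
  shows "smooth_on J (paraboloid_curve \<phi>)"
proof -
  have "smooth_on J (\<lambda>v::real. cos v)" "smooth_on J (\<lambda>v::real. sin v)"
    using smooth_on_sin_cos_combination[OF assms(1), of 0 1]
      smooth_on_sin_cos_combination[OF assms(1), of 1 0] by simp_all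
  moreover have "(\<phi> v)\<^sup>2 / 2 = \<phi> v * \<phi> v * (1 / 2)" for v
    by (simp add: power2_eq_square)
  ultimately show ?thesis
    unfolding paraboloid_curve_def[abs_def] using assms
    by (simp only:) (intro smooth_on_add smooth_on_scaleR smooth_on_mult smooth_on_const)
qed

text \<open>
  In the polar moving frame the first two derivatives of the plane curve have the components
  \<open>(\<phi>', \<phi>)\<close> and \<open>(\<phi>'' - \<phi>, 2 \<phi>')\<close>; since this frame is a rotated one, products can be computed from
  the components alone.
\<close>

lemma rotation_gram:
  fixes x y x' y' v :: real
  shows "(x * cos v - y * sin v) * (x' * cos v - y' * sin v)
    + (x * sin v + y * cos v) * (x' * sin v + y' * cos v) = x * x' + y * y'"
proof -
  have "(x * cos v - y * sin v) * (x' * cos v - y' * sin v)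
      + (x * sin v + y * cos v) * (x' * sin v + y' * cos v)
      = (x * x' + y * y') * ((sin v)\<^sup>2 + (cos v)\<^sup>2)"
    unfolding power2_eq_square by (simp only: algebra_simps)
  then show ?thesis by simp
qed

theorem proposition3p1:
  fixes a b :: real and I J :: "real set" and \<phi> :: "real \<Rightarrow> real"
  assumes "a < 0"
    and "open I" and "is_interval I" and "I \<noteq> {}" and "I \<subseteq> {0<..}"
    and "open J" and "is_interval J" and "J \<noteq> {}"
    and "smooth_on J \<phi>"
    and "\<forall>v\<in>J. (deriv \<phi> v)\<^sup>2 + (\<phi> v)\<^sup>2 > 0"
  shows "marginally_trapped (meridian_parabolic (\<lambda>u. u) (\<lambda>u. a * u + b) \<phi>)
           {p. p $ 1 \<in> I \<and> p $ 2 \<in> J}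
         \<longleftrightarrow> (\<forall>v\<in>J. (kappa_bar \<phi> v)\<^sup>2 = - 1 / (2 * a))"
proof -
  let ?c' = "\<lambda>v. (deriv \<phi> v * cos v - \<phi> v * sin v) *\<^sub>R e1
    + (deriv \<phi> v * sin v + \<phi> v * cos v) *\<^sub>R e2 + (\<phi> v * deriv \<phi> v) *\<^sub>R xi1 + 0 *\<^sub>R xi2"
  let ?c'' = "\<lambda>v. (deriv (deriv \<phi>) v * cos v - 2 * deriv \<phi> v * sin v - \<phi> v * cos v) *\<^sub>R e1
    + (deriv (deriv \<phi>) v * sin v + 2 * deriv \<phi> v * cos v - \<phi> v * sin v) *\<^sub>R e2
    + (\<phi> v * deriv (deriv \<phi>) v + (deriv \<phi> v)\<^sup>2) *\<^sub>R xi1 + 0 *\<^sub>R xi2"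
  let ?w = "\<lambda>v. (deriv \<phi> v)\<^sup>2 + (\<phi> v)\<^sup>2"
  have w_c': "mink (?c' v) (?c' v) = ?w v" for v
    unfolding mink_null_frame
    using rotation_gram[of "deriv \<phi> v" v "\<phi> v" "deriv \<phi> v" "\<phi> v"]
    by (simp add: power2_eq_square)
  have gram_c'': "mink (?c' v) (?c'' v) =
      deriv \<phi> v * (deriv (deriv \<phi>) v - \<phi> v) + \<phi> v * (2 * deriv \<phi> v)"
    "mink (?c'' v) (?c'' v) = (deriv (deriv \<phi>) v - \<phi> v)\<^sup>2 + (2 * deriv \<phi> v)\<^sup>2" for v
    unfolding mink_null_frame
    using rotation_gram[of "deriv \<phi> v" v "\<phi> v" "deriv (deriv \<phi>) v - \<phi> v" "2 * deriv \<phi> v"]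
      rotation_gram[of "deriv (deriv \<phi>) v - \<phi> v" v "2 * deriv \<phi> v"
        "deriv (deriv \<phi>) v - \<phi> v" "2 * deriv \<phi> v"]
    by (simp_all add: power2_eq_square algebra_simps)
  interpret S: null_curve_surface xi1 "paraboloid_curve \<phi>" ?c' ?c'' a b I J
  proof unfold_locales
    fix v assume v: "v \<in> J"
    show "(paraboloid_curve \<phi> has_vector_derivative ?c' v) (at v)"
      "(?c' has_vector_derivative ?c'' v) (at v)"
      using paraboloid_curve_derivs smooth_on_real_derivs[OF assms(6,9) v] by blast+
    show "0 < mink (?c' v) (?c' v)" unfolding w_c' using assms(10) v by blast
    show "mink (paraboloid_curve \<phi> v) (paraboloid_curve \<phi> v) = 0"
      unfolding paraboloid_curve_def mink_null_frame
      using rotation_gram[of "\<phi> v" v 0 "\<phi> v" 0] by (simp add: power2_eq_square)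
    show "mink (paraboloid_curve \<phi> v) xi1 = - 1"
      using mink_null_frame[of "\<phi> v * cos v" "\<phi> v * sin v" "(\<phi> v)\<^sup>2 / 2" 1 0 0 1 0]
      by (simp add: paraboloid_curve_def)
  next
    show "mink xi1 xi1 = 0"
      by (simp add: mink_def xi1_def axis_def)
  qed (use assms smooth_paraboloid_curve in auto)
  have z: "meridian_parabolic (\<lambda>u. u) (\<lambda>u. a * u + b) \<phi> = S.z"
    by (simp add: fun_eq_iff S.z_def meridian_parabolic_def paraboloid_curve_def Let_def
        algebra_simps)
  have lightlike: "lightlike (mean_curvature_vector S.z p) \<longleftrightarrow>
      (kappa_bar \<phi> (p $ 2))\<^sup>2 = - 1 / (2 * a)" if p: "p \<in> S.U" for p
  proof -
    define v where "v = p $ 2"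
    define w where "w = ?w v"
    have w: "w > 0" using S.U_D(2)[OF p] assms(10) by (simp add: v_def w_def)
    let ?k = "\<phi> v * deriv (deriv \<phi>) v - 2 * (deriv \<phi> v)\<^sup>2 - (\<phi> v)\<^sup>2"
    \<comment> \<open>Lagrange's identity: the Gram determinant is the square of
      \<open>\<phi>' \<cdot> 2 \<phi>' - \<phi> (\<phi>'' - \<phi>) = - ?k\<close>.\<close>
    have "lightlike (mean_curvature_vector S.z p) \<longleftrightarrow> ?k\<^sup>2 = - (w ^ 3 / (2 * a))"
      unfolding S.lightlike_mean_curvature_iff[OF p] v_def[symmetric] w_c' gram_c''
      unfolding w_def by (simp add: power2_eq_square power3_eq_cube algebra_simps)
    also have "?k\<^sup>2 = w ^ 3 * (kappa_bar \<phi> v)\<^sup>2"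
    proof -
      have "(w powr (3 / 2))\<^sup>2 = w ^ 3"
        using w by (simp add: powr_power)
      then have "(kappa_bar \<phi> v)\<^sup>2 = ?k\<^sup>2 / w ^ 3"
        by (simp add: kappa_bar_def w_def power_divide)
      then show ?thesis using w by simp
    qed
    also have "- (w ^ 3 / (2 * a)) = w ^ 3 * (- 1 / (2 * a))" by simp
    also have "w ^ 3 * (kappa_bar \<phi> v)\<^sup>2 = w ^ 3 * (- 1 / (2 * a)) \<longleftrightarrow>
        (kappa_bar \<phi> v)\<^sup>2 = - 1 / (2 * a)"
      using w by (subst mult_cancel_left) simp
    finally show ?thesis unfolding v_def .
  qed
  \<comment> \<open>The criterion at \<open>p\<close> involves \<open>v\<close> only, and each \<open>v \<in> J\<close> occurs because \<open>I\<close> is nonempty.\<close>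
  obtain u where u: "u \<in> I" using assms(4) by blast
  have "(\<forall>p\<in>S.U. (kappa_bar \<phi> (p $ 2))\<^sup>2 = - 1 / (2 * a)) \<longleftrightarrow>
      (\<forall>v\<in>J. (kappa_bar \<phi> v)\<^sup>2 = - 1 / (2 * a))" (is "?L \<longleftrightarrow> ?R")
  proof
    assume ?L
    show ?R
    proof
      fix v assume "v \<in> J"
      then have "vector [u, v] \<in> S.U" using u by (simp add: S.U_def)
      with \<open>?L\<close> show "(kappa_bar \<phi> v)\<^sup>2 = - 1 / (2 * a)" by fastforce
    qed
  qed (use S.U_D(2) in blast)
  then show ?thesis
    unfolding z S.U_def[symmetric] marginally_trapped_def
    using S.spacelike_z lightlike by simp
qed

end
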